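(* Let $H,G$ be finitely generated groups, with $H\neq\{1\}$ and $G$ infinite. Then $\mathrm{cb}^e(H\wr G)=\mathfrak{C}$.
   Context: The wreath product $H\wr G$ is the semidirect product $H^{(G)}\rtimes G$, where $H^{(G)}$ is the group of finitely supported functions $G\to H$ and $G$ acts by shifting. Let $\mathcal{G}_d$ be the set of normal subgroups $N$ of the free group $F_d$ of rank $d$, with the subspace topology from $\{0,1\}^{F_d}$; $N$ is identified with the marked group $F_d/N$. For a topological space $X$, set $X^{(0)}=X$, $X^{(\alpha+1)}$ = the set of accumulation points (non-isolated points) of the space $X^{(\alpha)}$, and $X^{(\lambda)}=\bigcap_{\beta<\lambda}X^{(\beta)}$ for limit ordinals $\lambda$. For $x\in X$, $\mathrm{CB}_X(x)=\sup\{\alpha : x\in X^{(\alpha)}\}$ if this supremum exists; otherwise (i.e. if $x\in X^{(\alpha)}$ for all ordinals $\alpha$) $\mathrm{CB}_X(x)=\mathfrak{C}$, a symbol that is not an ordinal. For a finitely generated group $\Gamma$ with a generating family of $d$ elements, i.e. a surjection $F_d\to\Gamma$ with kernel $N$, $\mathrm{cb}^e(\Gamma)=\mathrm{CB}_{\mathcal{G}_d}(N)$; this is known not to depend on the choice of the finite generating family. *)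

theory Defs
  imports "HOL-Algebra.Product_Groups" "HOL-Analysis.Function_Topology"
begin

section \<open>Wreath products\<close>

definition finitely_generated_group :: "('a, 'm) monoid_scheme \<Rightarrow> bool" where
  "finitely_generated_group G \<longleftrightarrow>
     group G \<and> (\<exists>S. finite S \<and> S \<subseteq> carrier G \<and> generate G S = carrier G)"

definition semidirect_product ::
  "('a, 'm) monoid_scheme \<Rightarrow> ('b, 'n) monoid_scheme \<Rightarrow> ('b \<Rightarrow> 'a \<Rightarrow> 'a) \<Rightarrow> ('a \<times> 'b) monoid" where
  "semidirect_product N Q act =
     \<lparr>carrier = carrier N \<times> carrier Q,
      monoid.mult = (\<lambda>(n, q) (n', q'). (n \<otimes>\<^bsub>N\<^esub> act q n', q \<otimes>\<^bsub>Q\<^esub> q')),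
      one = (\<one>\<^bsub>N\<^esub>, \<one>\<^bsub>Q\<^esub>)\<rparr>"

definition shift_action :: "('b, 'n) monoid_scheme \<Rightarrow> 'b \<Rightarrow> ('b \<Rightarrow> 'a) \<Rightarrow> ('b \<Rightarrow> 'a)" where
  "shift_action G g f = (\<lambda>x\<in>carrier G. f (inv\<^bsub>G\<^esub> g \<otimes>\<^bsub>G\<^esub> x))"

(* sum_group consists of the finitely supported functions carrier G -> carrier H,
   represented extensionally (undefined outside carrier G). *)
definition wreath_product ::
  "('a, 'm) monoid_scheme \<Rightarrow> ('b, 'n) monoid_scheme \<Rightarrow> (('b \<Rightarrow> 'a) \<times> 'b) monoid" where
  "wreath_product H G =
     semidirect_product (sum_group (carrier G) (\<lambda>_. H)) G (shift_action G)"


section \<open>Free groups of finite rank\<close>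

text \<open>The letter \<open>(i, True)\<close> is the generator \<open>x\<^sub>i\<close>, and \<open>(i, False)\<close> is its inverse.\<close>

type_synonym letter = "nat \<times> bool"

definition letter_inv :: "letter \<Rightarrow> letter" where
  "letter_inv = (\<lambda>(i, b). (i, \<not> b))"

definition reduced :: "letter list \<Rightarrow> bool" where
  "reduced w \<longleftrightarrow> (\<forall>k. Suc k < length w \<longrightarrow> w ! Suc k \<noteq> letter_inv (w ! k))"

fun cons_reduce :: "letter \<Rightarrow> letter list \<Rightarrow> letter list" where
  "cons_reduce x [] = [x]"
| "cons_reduce x (y # w) = (if y = letter_inv x then w else x # y # w)"

(* For a reduced word v, foldr cons_reduce u v is the reduced form of u @ v. *)
definition free_group :: "nat \<Rightarrow> letter list monoid" where
  "free_group d =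
     \<lparr>carrier = {w. reduced w \<and> fst ` set w \<subseteq> {..<d}},
      monoid.mult = (\<lambda>u v. foldr cons_reduce u v),
      one = []\<rparr>"


section \<open>The space of marked groups\<close>

(* A set N of words is mapped to its indicator function in {0,1}^(F_d); the topology
   is the one induced from the product topology along this injection. *)
definition marked_groups :: "nat \<Rightarrow> letter list set topology" where
  "marked_groups d =
     pullback_topology
       {N. N \<lhd> free_group d}
       (\<lambda>N. \<lambda>w\<in>carrier (free_group d). w \<in> N)
       (product_topology (\<lambda>_. discrete_topology (UNIV :: bool set)) (carrier (free_group d)))"


section \<open>Cantor-Bendixson rank\<close>

text \<open>
  Ordinals are represented as the elements of a well-ordered type \<open>'o\<close>: an element stands for
  the order type of the set of its strict predecessors.
\<close>

definition immediate_pred :: "'o::wellorder \<Rightarrow> 'o \<Rightarrow> bool" where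
  "immediate_pred \<beta> \<alpha> \<longleftrightarrow> \<beta> < \<alpha> \<and> \<not> (\<exists>\<gamma>. \<beta> < \<gamma> \<and> \<gamma> < \<alpha>)"

lemma the_immediate_pred:
  assumes "\<exists>\<beta>. immediate_pred \<beta> \<alpha>"
  shows "immediate_pred (THE \<beta>. immediate_pred \<beta> \<alpha>) \<alpha>"
  using assms by (rule exE) (rule theI, assumption, meson immediate_pred_def neqE)

function cb_derivative :: "'a topology \<Rightarrow> 'o::wellorder \<Rightarrow> 'a set" where
  "cb_derivative X \<alpha> =
     (if \<forall>\<beta>. \<alpha> \<le> \<beta> then topspace X
      else if \<exists>\<beta>. immediate_pred \<beta> \<alpha> then
        (let Y = cb_derivative X (THE \<beta>. immediate_pred \<beta> \<alpha>) in subtopology X Y derived_set_of Y)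
      else (\<Inter>\<beta>\<in>{..<\<alpha>}. cb_derivative X \<beta>))"
  by auto
termination
  by (relation "inv_image {(\<beta>, \<alpha>). \<beta> < \<alpha>} snd", rule wf_inv_image, rule wellorder_class.wf)
    (use the_immediate_pred in \<open>auto simp: immediate_pred_def\<close>)

declare cb_derivative.simps [simp del]

datatype 'o cb_value = Ordinal 'o | Frak_C

(* A type 'o without greatest element is a limit ordinal, and a set of smaller ordinals has a
   supremum there iff it is bounded; so Frak_C means that x lies in the derivatives for all
   ordinals represented in 'o. Every ordinal lies below some limit ordinal, so quantification
   over all ordinals is obtained by leaving 'o arbitrary: "rank Frak_C for every 'o". *)
definition cb_rank :: "'a topology \<Rightarrow> 'a \<Rightarrow> 'o::{wellorder,no_top} cb_value" where
  "cb_rank X x =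
     (let S = {\<alpha>::'o. x \<in> cb_derivative X \<alpha>} in
      if bdd_above S then Ordinal (LEAST u. \<forall>\<alpha>\<in>S. \<alpha> \<le> u) else Frak_C)"

(* The common value over all markings of the group by finite generating families. *)
definition cb_e :: "('g, 'm) monoid_scheme \<Rightarrow> 'o::{wellorder,no_top} cb_value" where
  "cb_e \<Gamma> =
     (THE c. \<exists>d. \<exists>\<phi>\<in>epi (free_group d) \<Gamma>.
        c = cb_rank (marked_groups d) (kernel (free_group d) \<Gamma> \<phi>))"

end

theory Submission
  imports Defs "HOL-Algebra.Bij" "HOL-Combinatorics.Transposition"
begin

text \<open>
  Let \<open>L\<close> be a group with two homomorphisms \<open>i, j: H \<rightarrow> L\<close> such that \<open>i h\<close> and \<open>j h\<close> do not
  commute for some \<open>h\<close>. For \<open>t \<noteq> 1\<close> in \<open>G\<close> the map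
  \<open>\<Theta>\<^sub>t (f, g) = (\<lambda>x. i (f x) j (f (x t\<^sup>-\<^sup>1)), g)\<close> from \<open>H \<wr> G\<close> to \<open>L \<wr> G\<close> is not a homomorphism, but any
  given pair of elements is multiplied correctly for all but finitely many \<open>t\<close>, because
  \<open>f (x t\<^sup>-\<^sup>1)\<close> and a translate of \<open>f' x\<close> are then never both nontrivial. Hence, for a marking \<open>\<phi>\<close> of
  \<open>H \<wr> G\<close> with kernel \<open>N\<close>, the homomorphisms \<open>\<theta>\<^sub>t\<close> from \<open>F\<^sub>d\<close> that send the generator \<open>x\<^sub>k\<close> to
  \<open>\<Theta>\<^sub>t (\<phi> x\<^sub>k)\<close> satisfy \<open>\<theta>\<^sub>t w = \<Theta>\<^sub>t (\<phi> w)\<close> for all but finitely many \<open>t\<close>, for each word \<open>w\<close>. In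
  particular every \<open>w \<in> N\<close> lies in \<open>ker \<theta>\<^sub>t\<close> for almost all \<open>t\<close>, so the normal subgroups
  \<open>N \<inter> \<Inter>\<^sub>t\<^sub>\<in>\<^sub>T ker \<theta>\<^sub>t\<close> with \<open>T\<close> finite form a set without isolated points, provided that they change
  when a further \<open>s\<close> is added to \<open>T\<close>. A word for \<open>[h, s h s\<^sup>-\<^sup>1]\<close> detects this: it is trivial in
  \<open>H \<wr> G\<close>, and \<open>\<theta>\<^sub>t\<close> kills it if and only if \<open>t \<notin> {s, s\<^sup>-\<^sup>1}\<close>.
\<close>

section \<open>Free groups\<close>

lemma letter_inv_letter_inv [simp]: "letter_inv (letter_inv x) = x"
  by (cases x) (simp add: letter_inv_def)

lemma fst_letter_inv [simp]: "fst (letter_inv x) = fst x"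
  by (cases x) (simp add: letter_inv_def)

lemma reduced_Nil [simp]: "reduced []"
  by (simp add: reduced_def)

lemma reduced_iff_successively: "reduced w \<longleftrightarrow> successively (\<lambda>x y. y \<noteq> letter_inv x) w"
  by (simp add: reduced_def successively_conv_nth)

lemma reduced_Cons:
  "reduced (x # w) \<longleftrightarrow> (w = [] \<or> hd w \<noteq> letter_inv x) \<and> reduced w"
  by (auto simp: reduced_iff_successively successively_Cons)

lemma reduced_cons_reduce: "reduced w \<Longrightarrow> reduced (cons_reduce x w)"
  by (cases w) (auto simp: reduced_Cons)

lemma set_cons_reduce: "set (cons_reduce x w) \<subseteq> insert x (set w)"
  by (cases w) auto

lemma cons_reduce_reduced: "reduced (x # w) \<Longrightarrow> cons_reduce x w = x # w"
  by (cases w) (auto simp: reduced_Cons)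

lemma cons_reduce_cancel:
  assumes "reduced w"
  shows "cons_reduce (letter_inv x) (cons_reduce x w) = w"
proof (cases w)
  case (Cons y v)
  with assms show ?thesis by (auto simp: cons_reduce_reduced)
qed simp

lemma reduced_foldr_cons_reduce: "reduced v \<Longrightarrow> reduced (foldr cons_reduce u v)"
  by (induction u) (auto intro: reduced_cons_reduce)

lemma set_foldr_cons_reduce: "set (foldr cons_reduce u v) \<subseteq> set u \<union> set v"
  by (induction u) (use set_cons_reduce in fastforce)+

text \<open>The case with content is a cancellation: if \<open>u\<close> starts with the inverse of
  \<open>x\<close>, the left side drops both letters, while on the right they act one after the
  other and undo each other by \<open>cons_reduce_cancel\<close>, as the word they act on is
  reduced. Associativity follows letter by letter.\<close>

lemma foldr_cons_reduce_cons_reduce: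
  assumes "reduced w"
  shows "foldr cons_reduce (cons_reduce x u) w = cons_reduce x (foldr cons_reduce u w)"
proof (cases u)
  case (Cons y v)
  have "cons_reduce x (cons_reduce (letter_inv x) (foldr cons_reduce v w)) = foldr cons_reduce v w"
    using cons_reduce_cancel [OF reduced_foldr_cons_reduce [OF assms], of "letter_inv x"] by simp
  with Cons show ?thesis by auto
qed simp

lemma foldr_cons_reduce_assoc:
  assumes "reduced w"
  shows "foldr cons_reduce (foldr cons_reduce u v) w = foldr cons_reduce u (foldr cons_reduce v w)"
  by (induction u) (simp_all add: foldr_cons_reduce_cons_reduce [OF assms])

lemma foldr_cons_reduce_rev_inv:
  "reduced u \<Longrightarrow> foldr cons_reduce (map letter_inv (rev u)) u = []"
proof (induction u)
  case (Cons x u)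
  then have "cons_reduce (letter_inv x) (x # u) = u"
    by (simp add: reduced_Cons)
  with Cons show ?case by (simp add: reduced_Cons)
qed simp

lemma one_free_group [simp]: "\<one>\<^bsub>free_group d\<^esub> = []"
  and mult_free_group [simp]: "u \<otimes>\<^bsub>free_group d\<^esub> v = foldr cons_reduce u v"
  by (simp_all add: free_group_def)

lemma carrier_free_group_iff:
  "w \<in> carrier (free_group d) \<longleftrightarrow> reduced w \<and> fst ` set w \<subseteq> {..<d}"
  by (simp add: free_group_def)

lemma group_free_group: "group (free_group d)"
proof (rule groupI)
  fix u v assume "u \<in> carrier (free_group d)" "v \<in> carrier (free_group d)"
  then show "u \<otimes>\<^bsub>free_group d\<^esub> v \<in> carrier (free_group d)"
    using set_foldr_cons_reduce [of u v]
    by (fastforce simp: carrier_free_group_iff reduced_foldr_cons_reduce)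
next
  fix u assume u: "u \<in> carrier (free_group d)"
  \<comment> \<open>Passing the formal inverse through \<open>cons_reduce\<close> makes it reduced
    by construction; by associativity it still cancels \<open>u\<close> one letter at a
    time.\<close>
  let ?u = "foldr cons_reduce (map letter_inv (rev u)) []"
  have "fst ` set ?u \<subseteq> fst ` letter_inv ` set u"
    using image_mono [OF set_foldr_cons_reduce [of "map letter_inv (rev u)" "[]"]] by simp
  also have "\<dots> \<subseteq> {..<d}"
    using u by (auto simp: carrier_free_group_iff)
  finally have "fst ` set ?u \<subseteq> {..<d}" .
  moreover have "foldr cons_reduce ?u u = []"
    using u by (simp add: foldr_cons_reduce_assoc foldr_cons_reduce_rev_inv carrier_free_group_iff
        del: map_map rev_map)
  ultimately show "\<exists>y\<in>carrier (free_group d). y \<otimes>\<^bsub>free_group d\<^esub> u = \<one>\<^bsub>free_group d\<^esub>"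
    by (metis carrier_free_group_iff mult_free_group one_free_group reduced_Nil
        reduced_foldr_cons_reduce)
qed (auto simp: carrier_free_group_iff foldr_cons_reduce_assoc)

section \<open>Evaluation of words: the universal property of the free group\<close>

definition word_eval :: "('a, 'm) monoid_scheme \<Rightarrow> (nat \<Rightarrow> 'a) \<Rightarrow> letter list \<Rightarrow> 'a" where
  "word_eval Q \<rho> w =
     foldr (\<lambda>(k, b) y. (if b then \<rho> k else inv\<^bsub>Q\<^esub> \<rho> k) \<otimes>\<^bsub>Q\<^esub> y) w \<one>\<^bsub>Q\<^esub>"

context group
begin

lemma word_eval_Nil [simp]: "word_eval G \<rho> [] = \<one>"
  by (simp add: word_eval_def)

lemma word_eval_Cons [simp]:
  "word_eval G \<rho> ((k, b) # w) = (if b then \<rho> k else inv (\<rho> k)) \<otimes> word_eval G \<rho> w"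
  by (simp add: word_eval_def)

lemma word_eval_closed:
  assumes "\<rho> \<in> {..<d} \<rightarrow> carrier G" "fst ` set w \<subseteq> {..<d}"
  shows "word_eval G \<rho> w \<in> carrier G"
  using assms(2)
proof (induction w)
  case (Cons x w)
  then show ?case using assms(1) by (cases x) auto
qed simp

text \<open>A cancelled pair of letters evaluates to an element times its inverse, so reduction does
  not change the value.\<close>

lemma word_eval_cons_reduce:
  assumes \<rho>: "\<rho> \<in> {..<d} \<rightarrow> carrier G" and kw: "fst ` set ((k, b) # w) \<subseteq> {..<d}"
  shows "word_eval G \<rho> (cons_reduce (k, b) w) = word_eval G \<rho> ((k, b) # w)"
proof (cases w)
  case (Cons y v)
  have "\<rho> k \<in> carrier G" "word_eval G \<rho> v \<in> carrier G"
    using \<rho> kw word_eval_closed [OF \<rho>, of v] by (auto simp: Cons)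
  then show ?thesis
    by (auto simp: Cons letter_inv_def m_assoc [symmetric])
qed simp

lemma word_eval_hom:
  assumes \<rho>: "\<rho> \<in> {..<d} \<rightarrow> carrier G"
  shows "word_eval G \<rho> \<in> hom (free_group d) G"
proof (rule homI)
  fix u v assume "u \<in> carrier (free_group d)" and v: "v \<in> carrier (free_group d)"
  then have "fst ` set u \<subseteq> {..<d}"
    by (simp add: carrier_free_group_iff)
  then show "word_eval G \<rho> (u \<otimes>\<^bsub>free_group d\<^esub> v) = word_eval G \<rho> u \<otimes> word_eval G \<rho> v"
  proof (induction u)
    case Nil
    then show ?case
      using v word_eval_closed [OF \<rho>, of v] by (simp add: carrier_free_group_iff)
  next
    case (Cons x u)
    obtain k b where x: "x = (k, b)" by (cases x)
    have "\<rho> k \<in> carrier G" "word_eval G \<rho> u \<in> carrier G" "word_eval G \<rho> v \<in> carrier G"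
      using \<rho> v Cons.prems word_eval_closed [OF \<rho>, of u] word_eval_closed [OF \<rho>, of v]
      by (auto simp: x carrier_free_group_iff)
    moreover have "fst ` set (x # foldr cons_reduce u v) \<subseteq> {..<d}"
      using Cons.prems v set_foldr_cons_reduce [of u v] by (fastforce simp: carrier_free_group_iff)
    ultimately show ?case
      using Cons word_eval_cons_reduce [OF \<rho>, of k b "foldr cons_reduce u v"]
      by (simp add: x m_assoc)
  qed
qed (use word_eval_closed [OF \<rho>] in \<open>simp add: carrier_free_group_iff\<close>)

lemma finitely_generated_imp_epi:
  assumes "finitely_generated_group G"
  shows "\<exists>d \<phi>. \<phi> \<in> epi (free_group d) G"
proof -
  obtain S where S: "finite S" "S \<subseteq> carrier G" "generate G S = carrier G"
    using assms by (auto simp: finitely_generated_group_def)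
  obtain \<rho> :: "nat \<Rightarrow> 'a" and d where \<rho>: "S = \<rho> ` {..<d}"
    using finite_imp_nat_seg_image_inj_on [OF S(1)] by (auto simp: lessThan_def)
  with S have hom: "word_eval G \<rho> \<in> hom (free_group d) G"
    by (intro word_eval_hom) auto
  note incl = generate_subgroup_incl
  interpret group_hom "free_group d" G "word_eval G \<rho>"
    by (simp add: group_hom_def group_hom_axioms_def group_free_group hom is_group)
  have "S \<subseteq> word_eval G \<rho> ` carrier (free_group d)"
  proof
    fix x assume "x \<in> S"
    then obtain k where k: "k < d" "x = \<rho> k" by (auto simp: \<rho>)
    then have "word_eval G \<rho> [(k, True)] = x" using S \<open>x \<in> S\<close> by auto
    moreover have "[(k, True)] \<in> carrier (free_group d)"
      using k by (simp add: carrier_free_group_iff reduced_def)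
    ultimately show "x \<in> word_eval G \<rho> ` carrier (free_group d)" by blast
  qed
  then have "carrier G \<subseteq> word_eval G \<rho> ` carrier (free_group d)"
    using incl [OF _ img_is_subgroup] S(3) by metis
  with hom have "word_eval G \<rho> \<in> epi (free_group d) G"
    by (auto simp: epi_def hom_in_carrier)
  then show ?thesis by blast
qed

end

text \<open>A single word involves finitely many products, and each of them is respected by
  \<open>\<Theta> t\<close> eventually; finitely many eventual conditions hold simultaneously. The
  exceptional \<open>t\<close> depend on the word, so no \<open>\<Theta> t\<close> need be a
  homomorphism.\<close>

lemma eventually_word_eval_eq:
  fixes \<F> :: "'t filter"
  assumes \<Gamma>: "group \<Gamma>" and Q: "group Q" and \<phi>: "\<phi> \<in> hom (free_group d) \<Gamma>"
    and closed: "\<forall>\<^sub>F t in \<F>. \<Theta> t \<in> carrier \<Gamma> \<rightarrow> carrier Q"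
    and mult: "\<And>x y. x \<in> carrier \<Gamma> \<Longrightarrow> y \<in> carrier \<Gamma> \<Longrightarrow>
      \<forall>\<^sub>F t in \<F>. \<Theta> t (x \<otimes>\<^bsub>\<Gamma>\<^esub> y) = \<Theta> t x \<otimes>\<^bsub>Q\<^esub> \<Theta> t y"
    and w: "w \<in> carrier (free_group d)"
  shows "\<forall>\<^sub>F t in \<F>. word_eval Q (\<lambda>k. \<Theta> t (\<phi> [(k, True)])) w = \<Theta> t (\<phi> w)"
proof -
  interpret \<Gamma>: group \<Gamma> by fact
  interpret Q: group Q by fact
  interpret group_hom "free_group d" \<Gamma> \<phi>
    by (simp add: group_hom_def group_hom_axioms_def group_free_group \<phi> \<Gamma>)
  \<comment> \<open>Once the product of one with itself is respected, the image of one is an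
    idempotent of a group.\<close>
  have one: "\<forall>\<^sub>F t in \<F>. \<Theta> t \<one>\<^bsub>\<Gamma>\<^esub> = \<one>\<^bsub>Q\<^esub>"
    using closed mult [OF \<Gamma>.one_closed \<Gamma>.one_closed]
  proof eventually_elim
    case (elim t)
    then have "\<Theta> t \<one>\<^bsub>\<Gamma>\<^esub> \<in> carrier Q" by auto
    with elim show ?case by (metis Q.l_cancel_one \<Gamma>.one_closed \<Gamma>.r_one)
  qed
  have letter_carrier: "[(k, b)] \<in> carrier (free_group d)" if "k < d" for k b
    using that by (simp add: carrier_free_group_iff reduced_def)
  show ?thesis using w
  proof (induction w)
    case Nil
    have "\<phi> [] = \<one>\<^bsub>\<Gamma>\<^esub>" using hom_one by simp
    with one show ?case by (auto elim: eventually_mono)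
  next
    case (Cons x w)
    obtain k b where x: "x = (k, b)" by (cases x)
    have k: "k < d" and w: "w \<in> carrier (free_group d)"
      using Cons.prems by (auto simp: x carrier_free_group_iff reduced_Cons)
    have letter: "\<phi> [(k, b)] \<in> carrier \<Gamma>" for b
      using letter_carrier [OF k] hom_closed by blast
    have inv: "\<phi> [(k, True)] \<otimes>\<^bsub>\<Gamma>\<^esub> \<phi> [(k, False)] = \<one>\<^bsub>\<Gamma>\<^esub>"
      using hom_mult [OF letter_carrier letter_carrier, OF k k, of True False] hom_one
      by (simp add: letter_inv_def)
    have "\<phi> (x # w) = \<phi> [x] \<otimes>\<^bsub>\<Gamma>\<^esub> \<phi> w"
      using hom_mult [OF letter_carrier [OF k] w, of b] Cons.prems
      by (simp add: x cons_reduce_reduced carrier_free_group_iff)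
    with mult [OF letter hom_closed [OF w], of b]
    have "\<forall>\<^sub>F t in \<F>. \<Theta> t (\<phi> (x # w)) = \<Theta> t (\<phi> [(k, b)]) \<otimes>\<^bsub>Q\<^esub> \<Theta> t (\<phi> w)"
      by (simp add: x)
    with closed one mult [OF letter letter, of True False] Cons.IH [OF w]
    show ?case
    proof eventually_elim
      case (elim t)
      have cl: "\<Theta> t (\<phi> [(k, b)]) \<in> carrier Q" for b
        using elim(1) letter by blast
      \<comment> \<open>\<open>word_eval\<close> inverts the image of the generator, so the twist
        has to respect this inverse too; it does as soon as it respects the product of the two
        letters and the identity.\<close>
      have "\<Theta> t (\<phi> [(k, False)]) = inv\<^bsub>Q\<^esub> \<Theta> t (\<phi> [(k, True)])"
        using elim(2,3) cl inv by (metis Q.inv_equality Q.inv_inv)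
      with elim show ?case by (simp add: x)
    qed
  qed
qed

section \<open>Cantor-Bendixson derivatives\<close>

text \<open>Transfinite induction: derived sets are monotone, so a set without isolated points that
  lies in one derivative lies in the next, and it passes to intersections at limits.\<close>

lemma dense_in_itself_subset_cb_derivative:
  assumes top: "Y \<subseteq> topspace X" and dense: "Y \<subseteq> subtopology X Y derived_set_of Y"
  shows "Y \<subseteq> cb_derivative X \<alpha>"
proof (induction \<alpha> rule: less_induct)
  case (less \<alpha>)
  show ?case
  proof (cases "\<forall>\<beta>. \<alpha> \<le> \<beta>")
    case True
    then have "cb_derivative X \<alpha> = topspace X"
      by (subst cb_derivative.simps) (rule if_P)
    with top show ?thesis by simp
  next
    case min: False
    show ?thesis
    proof (cases "\<exists>\<beta>. immediate_pred \<beta> \<alpha>")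
      case True
      define \<beta> where "\<beta> = (THE \<beta>. immediate_pred \<beta> \<alpha>)"
      define Y' where "Y' = cb_derivative X \<beta>"
      have "immediate_pred \<beta> \<alpha>"
        unfolding \<beta>_def by (rule the_immediate_pred [OF True])
      then have "Y \<subseteq> Y'"
        unfolding Y'_def by (intro less.IH) (simp add: immediate_pred_def)
      then have "subtopology X Y derived_set_of Y \<subseteq> subtopology X Y' derived_set_of Y'"
        using derived_set_of_mono [of Y Y' X] by (auto simp: derived_set_of_subtopology)
      moreover have "cb_derivative X \<alpha> = subtopology X Y' derived_set_of Y'"
        using min True by (subst cb_derivative.simps) (simp only: if_False if_True Let_def Y'_def \<beta>_def)
      ultimately show ?thesis using dense by simp
    next
      case False
      then have "cb_derivative X \<alpha> = (\<Inter>\<beta>\<in>{..<\<alpha>}. cb_derivative X \<beta>)"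
        using min by (subst cb_derivative.simps) (simp only: if_False)
      with less.IH show ?thesis by auto
    qed
  qed
qed

text \<open>The set of \<open>\<alpha>\<close> in the definition of the rank is then the whole type,
  which is unbounded for lack of a greatest element.\<close>

lemma cb_rank_eq_Frak_C:
  assumes "\<And>\<alpha> :: 'o::{wellorder,no_top}. x \<in> cb_derivative X \<alpha>"
  shows "cb_rank X x = (Frak_C :: 'o cb_value)"
proof -
  have "\<not> bdd_above (UNIV :: 'o set)"
    by (metis UNIV_I bdd_above.unfold gt_ex leD)
  then show ?thesis using assms by (simp add: cb_rank_def)
qed

section \<open>The topology on the space of marked groups\<close>

lemma topspace_marked_groups [simp]: "topspace (marked_groups d) = {N. N \<lhd> free_group d}"
  by (auto simp: marked_groups_def topspace_pullback_topology)

text \<open>A basic open set of the product restricts finitely many coordinates; these words form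
  \<open>E\<close>.\<close>

lemma openin_marked_groupsE:
  assumes "openin (marked_groups d) U" "N \<in> U"
  obtains E where "finite E" "E \<subseteq> carrier (free_group d)"
    "\<And>N'. N' \<lhd> free_group d \<Longrightarrow> N' \<inter> E = N \<inter> E \<Longrightarrow> N' \<in> U"
proof -
  let ?F = "carrier (free_group d)"
  let ?\<chi> = "\<lambda>N. \<lambda>w\<in>?F. w \<in> N"
  let ?P = "product_topology (\<lambda>_. discrete_topology (UNIV :: bool set)) ?F"
  obtain V where V: "openin ?P V" "U = ?\<chi> -` V \<inter> {N. N \<lhd> free_group d}"
    using assms(1) by (auto simp: marked_groups_def openin_pullback_topology)
  then have "?\<chi> N \<in> V" using assms(2) by auto
  with V(1) obtain B where B: "finite {w \<in> ?F. B w \<noteq> UNIV}" "?\<chi> N \<in> Pi\<^sub>E ?F B" "Pi\<^sub>E ?F B \<subseteq> V"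
    by (auto simp: openin_product_topology_alt)
  show thesis
  proof
    fix N' assume N': "N' \<lhd> free_group d" "N' \<inter> {w \<in> ?F. B w \<noteq> UNIV} = N \<inter> {w \<in> ?F. B w \<noteq> UNIV}"
    have "(w \<in> N') \<in> B w" if "w \<in> ?F" for w
    proof (cases "B w = UNIV")
      case False
      then have "w \<in> N' \<longleftrightarrow> w \<in> N" using N'(2) that by blast
      with B(2) that show ?thesis by (auto dest: PiE_mem)
    qed simp
    then have "?\<chi> N' \<in> V" using B(3) by auto
    with V N' show "N' \<in> U" by simp
  qed (use B in auto)
qed

text \<open>The sets \<open>N \<inter> \<Inter>(K ` T)\<close> with \<open>T\<close> finite accumulate at one another: adding a late index to
  \<open>T\<close> does not change membership of any of finitely many words.\<close>

lemma cb_rank_eq_Frak_C_if_eventually_mem: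
  fixes \<F> :: "'t filter" and K :: "'t \<Rightarrow> letter list set"
  assumes N: "N \<lhd> free_group d" and K: "\<And>t. t \<in> J \<Longrightarrow> K t \<lhd> free_group d"
    and "\<F> \<noteq> bot"
    and mem: "\<And>w. w \<in> N \<Longrightarrow> \<forall>\<^sub>F t in \<F>. w \<in> K t"
    and separate: "\<And>T. finite T \<Longrightarrow> T \<subseteq> J \<Longrightarrow> \<forall>\<^sub>F s in \<F>. s \<in> J \<and> \<not> N \<inter> \<Inter>(K ` T) \<subseteq> K s"
  shows "cb_rank (marked_groups d) N = (Frak_C :: 'o::{wellorder,no_top} cb_value)"
proof (rule cb_rank_eq_Frak_C)
  define M where "M T = N \<inter> \<Inter>(K ` T)" for T
  define Y where "Y = M ` {T. finite T \<and> T \<subseteq> J}"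
  have normal: "M T \<lhd> free_group d" if "finite T" "T \<subseteq> J" for T
    using that
  proof (induction T rule: finite_induct)
    case empty
    then show ?case by (simp add: M_def N)
  next
    case (insert t T)
    have "M (insert t T) = K t \<inter> M T" by (auto simp: M_def)
    with insert K show ?case by (simp add: group.normal_subgroup_intersect [OF group_free_group])
  qed
  have Y_top: "Y \<subseteq> topspace (marked_groups d)"
    using normal by (auto simp: Y_def)
  have "M T \<in> marked_groups d derived_set_of Y" if T: "finite T" "T \<subseteq> J" for T
    unfolding in_derived_set_of
  proof (intro conjI allI impI)
    fix U assume U: "M T \<in> U \<and> openin (marked_groups d) U"
    then obtain E where E: "finite E"
      "\<And>N'. N' \<lhd> free_group d \<Longrightarrow> N' \<inter> E = M T \<inter> E \<Longrightarrow> N' \<in> U"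
      by (auto elim: openin_marked_groupsE)
    \<comment> \<open>Only the words of \<open>E\<close> that lie in \<open>N\<close> can be lost by
      intersecting with \<open>K s\<close>, and there are finitely many of them.\<close>
    have "\<forall>\<^sub>F s in \<F>. \<forall>w\<in>E \<inter> N. w \<in> K s"
      using E(1) mem by (intro eventually_ball_finite) auto
    with separate [OF T] have "\<forall>\<^sub>F s in \<F>. s \<in> J \<and> \<not> M T \<subseteq> K s \<and> E \<inter> N \<subseteq> K s"
      by eventually_elim (auto simp: M_def)
    then obtain s where s: "s \<in> J" "\<not> M T \<subseteq> K s" "E \<inter> N \<subseteq> K s"
      using \<open>\<F> \<noteq> bot\<close> eventually_happens' by blast
    have eq: "M (insert s T) = M T \<inter> K s" by (auto simp: M_def)
    have "M (insert s T) \<inter> E = M T \<inter> E"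
      using s(3) by (auto simp: eq) (auto simp: M_def)
    then have "M (insert s T) \<in> U"
      using E(2) normal [of "insert s T"] T s(1) by simp
    moreover have "M (insert s T) \<in> Y" using T s(1) by (auto simp: Y_def)
    moreover have "M (insert s T) \<noteq> M T" using s(2) eq by blast
    ultimately show "\<exists>N'\<noteq>M T. N' \<in> Y \<and> N' \<in> U" by blast
  qed (use T normal in \<open>auto simp: Y_def\<close>)
  then have "Y \<subseteq> subtopology (marked_groups d) Y derived_set_of Y"
    by (auto simp: Y_def derived_set_of_subtopology)
  then have "Y \<subseteq> cb_derivative (marked_groups d) \<alpha>" for \<alpha> :: 'o
    by (rule dense_in_itself_subset_cb_derivative [OF Y_top])
  \<comment> \<open>The empty index set puts \<open>N\<close> itself into the family without
    isolated points.\<close>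
  moreover have "N = M {}" by (simp add: M_def)
  then have "N \<in> Y" by (simp add: Y_def image_iff) blast
  ultimately show "N \<in> cb_derivative (marked_groups d) \<alpha>" for \<alpha> :: 'o
    by blast
qed

section \<open>Wreath products\<close>

lemma group_semidirect_product:
  assumes N: "group N" and Q: "group Q"
    and hom: "\<And>q. q \<in> carrier Q \<Longrightarrow> act q \<in> hom N N"
    and mult: "\<And>p q n. p \<in> carrier Q \<Longrightarrow> q \<in> carrier Q \<Longrightarrow> n \<in> carrier N \<Longrightarrow>
      act (p \<otimes>\<^bsub>Q\<^esub> q) n = act p (act q n)"
    and one: "\<And>n. n \<in> carrier N \<Longrightarrow> act \<one>\<^bsub>Q\<^esub> n = n"
  shows "group (semidirect_product N Q act)"
proof -
  interpret N: group N by fact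
  interpret Q: group Q by fact
  have closed: "act q n \<in> carrier N" if "q \<in> carrier Q" "n \<in> carrier N" for q n
    using hom that by (auto simp: hom_def)
  have hom_mult: "act q (m \<otimes>\<^bsub>N\<^esub> n) = act q m \<otimes>\<^bsub>N\<^esub> act q n"
    if "q \<in> carrier Q" "m \<in> carrier N" "n \<in> carrier N" for q m n
    using hom that by (auto simp: hom_def)
  have act_one: "act q \<one>\<^bsub>N\<^esub> = \<one>\<^bsub>N\<^esub>" if "q \<in> carrier Q" for q
    using hom_mult [OF that N.one_closed N.one_closed] closed [OF that N.one_closed]
    by (simp add: N.l_cancel_one)
  show ?thesis
  proof (rule groupI)
    fix x assume "x \<in> carrier (semidirect_product N Q act)"
    then obtain n q where x: "x = (n, q)" "n \<in> carrier N" "q \<in> carrier Q"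
      by (auto simp: semidirect_product_def)
    show "\<exists>y\<in>carrier (semidirect_product N Q act).
        y \<otimes>\<^bsub>semidirect_product N Q act\<^esub> x = \<one>\<^bsub>semidirect_product N Q act\<^esub>"
      \<comment> \<open>With this witness the base component of the product is the image of one
        under \<open>act\<close> of the inverse of \<open>q\<close>, hence one by
        \<open>act_one\<close>.\<close>
      by (rule bexI [of _ "(act (inv\<^bsub>Q\<^esub> q) (inv\<^bsub>N\<^esub> n), inv\<^bsub>Q\<^esub> q)"])
        (use x in \<open>simp_all add: semidirect_product_def closed act_one hom_mult [symmetric]\<close>)
  qed (auto simp: semidirect_product_def closed hom_mult mult one N.m_assoc Q.m_assoc)
qed

section \<open>Wreath products in coordinates, for an arbitrary base group \<open>K\<close>\<close>

locale wreath = K: group K + G: group G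
  for K :: "('a, 'm) monoid_scheme" and G :: "('b, 'n) monoid_scheme"
begin

abbreviation W :: "(('b \<Rightarrow> 'a) \<times> 'b) monoid" where "W \<equiv> wreath_product K G"

definition supp :: "('b \<Rightarrow> 'a) \<Rightarrow> 'b set" where
  "supp f = {x \<in> carrier G. f x \<noteq> \<one>\<^bsub>K\<^esub>}"

definition finsupp :: "('b \<Rightarrow> 'a) set" where
  "finsupp = {f \<in> carrier G \<rightarrow>\<^sub>E carrier K. finite (supp f)}"

lemma finsuppD:
  assumes "f \<in> finsupp"
  shows "x \<in> carrier G \<Longrightarrow> f x \<in> carrier K" "finite (supp f)" "f \<in> extensional (carrier G)"
  using assms by (auto simp: finsupp_def PiE_def)

lemma finsupp_restrictI:
  assumes "\<And>x. x \<in> carrier G \<Longrightarrow> f x \<in> carrier K"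
    and "finite S" and "\<And>x. x \<in> carrier G \<Longrightarrow> x \<notin> S \<Longrightarrow> f x = \<one>\<^bsub>K\<^esub>"
  shows "restrict f (carrier G) \<in> finsupp"
proof -
  have "supp (restrict f (carrier G)) \<subseteq> S"
    using assms(3) by (auto simp: supp_def)
  with assms show ?thesis by (auto simp: finsupp_def intro: finite_subset)
qed

lemma carrier_sum_group_eq_finsupp: "carrier (sum_group (carrier G) (\<lambda>_. K)) = finsupp"
  by (simp add: carrier_sum_group finsupp_def supp_def K.group_axioms)

lemma shift_action_closed:
  assumes g: "g \<in> carrier G" and f: "f \<in> finsupp"
  shows "shift_action G g f \<in> finsupp"
  unfolding shift_action_def
proof (rule finsupp_restrictI)
  show "finite ((\<lambda>y. g \<otimes>\<^bsub>G\<^esub> y) ` supp f)" using f by (simp add: finsuppD)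
  fix x assume x: "x \<in> carrier G" "x \<notin> (\<lambda>y. g \<otimes>\<^bsub>G\<^esub> y) ` supp f"
  show "f (inv\<^bsub>G\<^esub> g \<otimes>\<^bsub>G\<^esub> x) = \<one>\<^bsub>K\<^esub>"
  proof (rule ccontr)
    assume "f (inv\<^bsub>G\<^esub> g \<otimes>\<^bsub>G\<^esub> x) \<noteq> \<one>\<^bsub>K\<^esub>"
    then have "inv\<^bsub>G\<^esub> g \<otimes>\<^bsub>G\<^esub> x \<in> supp f" using g x by (simp add: supp_def)
    moreover have "x = g \<otimes>\<^bsub>G\<^esub> (inv\<^bsub>G\<^esub> g \<otimes>\<^bsub>G\<^esub> x)"
      using g x by (simp add: G.m_assoc [symmetric])
    ultimately show False using x by blast
  qed
qed (use g f in \<open>auto intro: finsuppD\<close>)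

lemma group_W: "group W"
  unfolding wreath_product_def
proof (rule group_semidirect_product)
  show "shift_action G q \<in> hom (sum_group (carrier G) (\<lambda>_. K)) (sum_group (carrier G) (\<lambda>_. K))"
    if "q \<in> carrier G" for q
    using that shift_action_closed [OF that]
    by (auto simp: hom_def carrier_sum_group_eq_finsupp) (auto simp: shift_action_def)
  show "shift_action G (p \<otimes>\<^bsub>G\<^esub> q) f = shift_action G p (shift_action G q f)"
    if "p \<in> carrier G" "q \<in> carrier G" for p q f
    using that by (auto simp: shift_action_def G.inv_mult_group G.m_assoc)
  show "shift_action G \<one>\<^bsub>G\<^esub> f = f" if "f \<in> carrier (sum_group (carrier G) (\<lambda>_. K))" for f
    using that finsuppD(3) [of f]
    by (auto simp: shift_action_def carrier_sum_group_eq_finsupp extensional_def)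
qed (auto simp: K.group_axioms G.group_axioms)

sublocale W: group W by (rule group_W)

lemma carrier_W: "carrier W = finsupp \<times> carrier G"
  by (simp add: wreath_product_def semidirect_product_def carrier_sum_group_eq_finsupp)

lemma one_W: "\<one>\<^bsub>W\<^esub> = (\<lambda>x\<in>carrier G. \<one>\<^bsub>K\<^esub>, \<one>\<^bsub>G\<^esub>)"
  by (simp add: wreath_product_def semidirect_product_def)

lemma mult_W:
  "(f, g) \<otimes>\<^bsub>W\<^esub> (f', g') =
    (\<lambda>x\<in>carrier G. f x \<otimes>\<^bsub>K\<^esub> f' (inv\<^bsub>G\<^esub> g \<otimes>\<^bsub>G\<^esub> x), g \<otimes>\<^bsub>G\<^esub> g')"
  by (auto simp: wreath_product_def semidirect_product_def shift_action_def)

definition at_one :: "'a \<Rightarrow> ('b \<Rightarrow> 'a) \<times> 'b" where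
  "at_one h = (\<lambda>x\<in>carrier G. if x = \<one>\<^bsub>G\<^esub> then h else \<one>\<^bsub>K\<^esub>, \<one>\<^bsub>G\<^esub>)"

definition top_elem :: "'b \<Rightarrow> ('b \<Rightarrow> 'a) \<times> 'b" where
  "top_elem g = (\<lambda>x\<in>carrier G. \<one>\<^bsub>K\<^esub>, g)"

lemma const_one_finsupp: "(\<lambda>x\<in>carrier G. \<one>\<^bsub>K\<^esub>) \<in> finsupp"
  by (rule finsupp_restrictI [of _ "{}"]) auto

lemma single_finsupp:
  "h \<in> carrier K \<Longrightarrow> (\<lambda>x\<in>carrier G. if x = a then h else \<one>\<^bsub>K\<^esub>) \<in> finsupp"
  by (rule finsupp_restrictI [of _ "{a}"]) auto

lemma top_elem_hom: "top_elem \<in> hom G W"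
  by (rule homI) (auto simp: top_elem_def carrier_W const_one_finsupp mult_W)

lemma at_one_hom: "at_one \<in> hom K W"
  by (rule homI) (auto simp: at_one_def carrier_W single_finsupp mult_W)

lemma top_elem_closed [simp]: "g \<in> carrier G \<Longrightarrow> top_elem g \<in> carrier W"
  using top_elem_hom by (auto simp: hom_def)

lemma inv_top_elem: "g \<in> carrier G \<Longrightarrow> inv\<^bsub>W\<^esub> top_elem g = top_elem (inv\<^bsub>G\<^esub> g)"
  by (rule W.inv_equality) (auto simp: top_elem_def mult_W one_W carrier_W const_one_finsupp)

lemma conj_top_elem:
  assumes "g \<in> carrier G" "f \<in> finsupp"
  shows "top_elem g \<otimes>\<^bsub>W\<^esub> (f, \<one>\<^bsub>G\<^esub>) \<otimes>\<^bsub>W\<^esub> inv\<^bsub>W\<^esub> top_elem g = (shift_action G g f, \<one>\<^bsub>G\<^esub>)"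
  using assms
  by (auto simp: inv_top_elem) (auto simp: top_elem_def mult_W shift_action_def finsuppD)

text \<open>Conjugation by a top element is the shift, and base elements multiply pointwise, so
  commutation can be tested in each coordinate. The criterion is applied over both base groups
  \<open>H\<close> and \<open>L\<close>.\<close>

lemma commute_conj_iff:
  assumes g: "g \<in> carrier G" and f: "f \<in> finsupp"
  defines "X \<equiv> (f, \<one>\<^bsub>G\<^esub>)"
  defines "Y \<equiv> top_elem g \<otimes>\<^bsub>W\<^esub> X \<otimes>\<^bsub>W\<^esub> inv\<^bsub>W\<^esub> top_elem g"
  shows "X \<otimes>\<^bsub>W\<^esub> Y = Y \<otimes>\<^bsub>W\<^esub> X \<longleftrightarrow>
    (\<forall>x\<in>carrier G. f x \<otimes>\<^bsub>K\<^esub> f (inv\<^bsub>G\<^esub> g \<otimes>\<^bsub>G\<^esub> x) = f (inv\<^bsub>G\<^esub> g \<otimes>\<^bsub>G\<^esub> x) \<otimes>\<^bsub>K\<^esub> f x)"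
proof -
  have restrict_eq: "restrict u (carrier G) = restrict v (carrier G) \<longleftrightarrow> (\<forall>x\<in>carrier G. u x = v x)"
    for u v :: "'b \<Rightarrow> 'a"
    by (auto simp: restrict_def fun_eq_iff)
  show ?thesis
    using g f unfolding X_def Y_def conj_top_elem [OF g f]
    by (simp add: mult_W shift_action_def restrict_eq cong: ball_cong)
qed

text \<open>Conjugating \<open>at_one h\<close> by top elements places \<open>h\<close> at any
  coordinate; finite products of such elements give the base group, and a top factor gives the
  rest.\<close>

lemma generate_W:
  assumes A: "A \<subseteq> carrier K" "generate K A = carrier K"
    and B: "B \<subseteq> carrier G" "generate G B = carrier G"
  shows "generate W (at_one ` A \<union> top_elem ` B) = carrier W" (is "?S = _")
proof
  interpret at_one: group_hom K W at_one
    by unfold_locales (rule at_one_hom)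
  interpret top_elem: group_hom G W top_elem
    by unfold_locales (rule top_elem_hom)
  have gens: "at_one ` A \<union> top_elem ` B \<subseteq> carrier W"
    using A B by auto
  then show "?S \<subseteq> carrier W" by (rule W.generate_incl)
  interpret S: subgroup ?S W using gens by (rule W.generate_is_subgroup)
  have base: "at_one h \<in> ?S" if "h \<in> carrier K" for h
    using at_one.generate_img [OF A(1)] W.mono_generate [of "at_one ` A" "at_one ` A \<union> top_elem ` B"]
      that A(2) by blast
  have top: "top_elem g \<in> ?S" if "g \<in> carrier G" for g
    using top_elem.generate_img [OF B(1)] W.mono_generate [of "top_elem ` B" "at_one ` A \<union> top_elem ` B"]
      that B(2) by blast
  have single: "(\<lambda>x\<in>carrier G. if x = a then h else \<one>\<^bsub>K\<^esub>, \<one>\<^bsub>G\<^esub>) \<in> ?S"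
    if a: "a \<in> carrier G" and h: "h \<in> carrier K" for a h
  proof -
    have "top_elem a \<otimes>\<^bsub>W\<^esub> at_one h \<otimes>\<^bsub>W\<^esub> inv\<^bsub>W\<^esub> top_elem a \<in> ?S"
      using base [OF h] top [OF a] by simp
    also have "top_elem a \<otimes>\<^bsub>W\<^esub> at_one h \<otimes>\<^bsub>W\<^esub> inv\<^bsub>W\<^esub> top_elem a =
        (\<lambda>x\<in>carrier G. if x = a then h else \<one>\<^bsub>K\<^esub>, \<one>\<^bsub>G\<^esub>)"
      using a h unfolding at_one_def
      by (subst conj_top_elem)
        (auto simp: single_finsupp shift_action_def G.inv_solve_left' intro!: restrict_ext)
    finally show ?thesis .
  qed
  have base_group: "(f, \<one>\<^bsub>G\<^esub>) \<in> ?S" if "finite T" "f \<in> finsupp" "supp f = T" for f T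
    using that
  proof (induction T arbitrary: f rule: finite_induct)
    case empty
    then have "f = (\<lambda>x\<in>carrier G. \<one>\<^bsub>K\<^esub>)"
      using finsuppD(3) [of f] by (auto simp: supp_def extensional_def)
    then show ?case using S.one_closed by (simp only: one_W)
  next
    case (insert a T)
    have a: "a \<in> carrier G" using insert.prems by (auto simp: supp_def)
    \<comment> \<open>Erasing the value at \<open>a\<close> removes one point from the support;
      multiplying by the single-coordinate element at \<open>a\<close> restores it.\<close>
    let ?f = "\<lambda>x\<in>carrier G. if x = a then \<one>\<^bsub>K\<^esub> else f x"
    have "f x = \<one>\<^bsub>K\<^esub>" if "x \<in> carrier G" "x \<notin> insert a T" for x
      using that insert.prems(2) by (auto simp: supp_def)
    then have f: "?f \<in> finsupp"
      using insert.prems(1) insert.hyps(1)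
      by (intro finsupp_restrictI [of _ "insert a T"]) (auto simp: finsuppD)
    have "supp ?f = T"
      using insert.prems(2) insert.hyps(2) by (auto simp: supp_def split: if_splits)
    with insert.IH f have "(?f, \<one>\<^bsub>G\<^esub>) \<in> ?S" by blast
    with single [OF a finsuppD(1) [OF insert.prems(1) a]]
    have "(\<lambda>x\<in>carrier G. if x = a then f a else \<one>\<^bsub>K\<^esub>, \<one>\<^bsub>G\<^esub>) \<otimes>\<^bsub>W\<^esub> (?f, \<one>\<^bsub>G\<^esub>) \<in> ?S"
      by (rule S.m_closed)
    also have "(\<lambda>x\<in>carrier G. if x = a then f a else \<one>\<^bsub>K\<^esub>, \<one>\<^bsub>G\<^esub>) \<otimes>\<^bsub>W\<^esub> (?f, \<one>\<^bsub>G\<^esub>) = (f, \<one>\<^bsub>G\<^esub>)"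
      using insert.prems(1) finsuppD [OF insert.prems(1)]
      by (auto simp: mult_W extensional_def fun_eq_iff)
    finally show ?case .
  qed
  show "carrier W \<subseteq> ?S"
  proof
    fix x assume "x \<in> carrier W"
    then obtain f g where x: "x = (f, g)" "f \<in> finsupp" "g \<in> carrier G"
      by (auto simp: carrier_W)
    have "(f, \<one>\<^bsub>G\<^esub>) \<otimes>\<^bsub>W\<^esub> top_elem g \<in> ?S"
      using base_group [OF finsuppD(2)] top x by simp
    also have "(f, \<one>\<^bsub>G\<^esub>) \<otimes>\<^bsub>W\<^esub> top_elem g = x"
      using x finsuppD [OF x(2)] by (auto simp: mult_W top_elem_def extensional_def fun_eq_iff)
    finally show "x \<in> ?S" .
  qed
qed

end

lemma finitely_generated_wreath_product:
  assumes "finitely_generated_group K" "finitely_generated_group G"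
  shows "finitely_generated_group (wreath_product K G)"
proof -
  obtain A B where A: "finite A" "A \<subseteq> carrier K" "generate K A = carrier K"
    and B: "finite B" "B \<subseteq> carrier G" "generate G B = carrier G"
    using assms by (auto simp: finitely_generated_group_def)
  interpret wreath K G
    using assms by (simp add: wreath_def finitely_generated_group_def)
  have "at_one ` A \<union> top_elem ` B \<subseteq> carrier W"
    using A B at_one_hom by (auto simp: hom_def)
  with generate_W [OF A(2,3) B(2,3)] A(1) B(1) show ?thesis
    unfolding finitely_generated_group_def
    by (intro conjI group_W exI [of _ "at_one ` A \<union> top_elem ` B"]) simp_all
qed

text \<open>Let \<open>H\<close> act on itself by left multiplication, with \<open>None\<close> as
  an additional fixed point; this is \<open>i\<close>. Conjugating by the transposition of
  \<open>None\<close> and the identity element gives \<open>j\<close>, whose image fixes the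
  identity element but not the other elements of \<open>H\<close>.\<close>

lemma ex_noncommuting_homs:
  fixes H :: "('h, 'm) monoid_scheme"
  assumes "group H"
  obtains L :: "('h option \<Rightarrow> 'h option) monoid" and i j
  where "group L" "i \<in> hom H L" "j \<in> hom H L"
    "\<And>h. h \<in> carrier H \<Longrightarrow> h \<noteq> \<one>\<^bsub>H\<^esub> \<Longrightarrow> i h \<otimes>\<^bsub>L\<^esub> j h \<noteq> j h \<otimes>\<^bsub>L\<^esub> i h"
proof -
  interpret group H by fact
  let ?L = "BijGroup (UNIV :: 'h option set)"
  have carrier_L: "f \<in> carrier ?L \<longleftrightarrow> bij f" for f
    by (simp add: BijGroup_def Bij_def extensional_def)
  have mult_L: "f \<otimes>\<^bsub>?L\<^esub> g = f \<circ> g" if "bij f" "bij g" for f g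
    using that by (auto simp: BijGroup_def Bij_def extensional_def compose_def)
  \<comment> \<open>Points outside the carrier are fixed, so that \<open>i h\<close> is a bijection
    of the whole type.\<close>
  define i where "i h = map_option (\<lambda>y. if y \<in> carrier H then h \<otimes>\<^bsub>H\<^esub> y else y)" for h
  define \<tau> where "\<tau> = Transposition.transpose None (Some \<one>\<^bsub>H\<^esub>)"
  define j where "j h = \<tau> \<circ> i h \<circ> \<tau>" for h
  have i_mult: "i (g \<otimes>\<^bsub>H\<^esub> h) = i g \<circ> i h" if "g \<in> carrier H" "h \<in> carrier H" for g h
    using that by (auto simp: i_def fun_eq_iff option.map_comp m_assoc intro!: map_option_cong)
  have i_one: "i \<one>\<^bsub>H\<^esub> = id"
    by (auto simp: i_def fun_eq_iff map_option_idI)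
  have bij_i: "bij (i h)" if "h \<in> carrier H" for h
    by (rule o_bij [of "i (inv\<^bsub>H\<^esub> h)"]) (use that in \<open>simp_all flip: i_mult add: i_one\<close>)
  have bij_\<tau>: "bij \<tau>" and \<tau>: "\<tau> \<circ> \<tau> = id"
    by (simp_all add: \<tau>_def)
  have bij_j: "bij (j h)" if "h \<in> carrier H" for h
    using bij_i [OF that] bij_\<tau> by (simp add: j_def bij_comp)
  have "i h \<circ> j h \<noteq> j h \<circ> i h" if h: "h \<in> carrier H" "h \<noteq> \<one>\<^bsub>H\<^esub>" for h
  proof
    assume "i h \<circ> j h = j h \<circ> i h"
    \<comment> \<open>At this point the left side is \<open>Some h\<close>. The right side is the
      transposition applied to the square of \<open>h\<close>: \<open>None\<close> if the square is
      trivial, and the square otherwise.\<close>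
    then have "i h (j h (Some \<one>\<^bsub>H\<^esub>)) = j h (i h (Some \<one>\<^bsub>H\<^esub>))"
      by (metis comp_apply)
    then have "h = h \<otimes>\<^bsub>H\<^esub> h"
      using h by (auto simp: i_def j_def \<tau>_def transpose_def split: if_splits)
    with h show False by (metis l_cancel_one)
  qed
  moreover have "j (g \<otimes>\<^bsub>H\<^esub> h) = j g \<circ> j h" if "g \<in> carrier H" "h \<in> carrier H" for g h
    using that \<tau> by (simp add: j_def i_mult comp_assoc) (metis comp_assoc comp_id)
  ultimately show thesis
    using that [of ?L i j] group_BijGroup
    by (auto simp: hom_def carrier_L mult_L bij_i bij_j i_mult)
qed

section \<open>Condensation of wreath products\<close>

text \<open>The translation by \<open>t\<close> is on the right, so it commutes with the left shift
  of the wreath product. Multiplicativity can then fail only because \<open>i\<close> and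
  \<open>j\<close> factors appear in a different order.\<close>

definition wreath_twist ::
  "('c, 'k) monoid_scheme \<Rightarrow> ('b, 'n) monoid_scheme \<Rightarrow> ('a \<Rightarrow> 'c) \<Rightarrow> ('a \<Rightarrow> 'c) \<Rightarrow> 'b \<Rightarrow>
    ('b \<Rightarrow> 'a) \<times> 'b \<Rightarrow> ('b \<Rightarrow> 'c) \<times> 'b" where
  "wreath_twist L G i j t =
     (\<lambda>(f, g). (\<lambda>x\<in>carrier G. i (f x) \<otimes>\<^bsub>L\<^esub> j (f (x \<otimes>\<^bsub>G\<^esub> inv\<^bsub>G\<^esub> t)), g))"

text \<open>This turns the vanishing of the commutator word for \<open>u\<close> and its conjugate
  into a commutation in the target; it serves for \<open>\<phi>\<close> and for every
  \<open>\<theta> t\<close>.\<close>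

lemma (in group_hom) commutator_conj_in_kernel_iff:
  assumes "u \<in> carrier G" "w \<in> carrier G"
  shows "(u \<otimes> (w \<otimes> u \<otimes> inv w)) \<otimes> inv ((w \<otimes> u \<otimes> inv w) \<otimes> u) \<in> kernel G H h \<longleftrightarrow>
    h u \<otimes>\<^bsub>H\<^esub> (h w \<otimes>\<^bsub>H\<^esub> h u \<otimes>\<^bsub>H\<^esub> inv\<^bsub>H\<^esub> h w) = (h w \<otimes>\<^bsub>H\<^esub> h u \<otimes>\<^bsub>H\<^esub> inv\<^bsub>H\<^esub> h w) \<otimes>\<^bsub>H\<^esub> h u"
proof -
  have "a \<otimes> inv b \<in> kernel G H h \<longleftrightarrow> h a = h b" if "a \<in> carrier G" "b \<in> carrier G" for a b
    using that H.inv_solve_right' [of "\<one>\<^bsub>H\<^esub>" "h a" "h b"] by (auto simp: kernel_def)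
  with assms show ?thesis by simp
qed

section \<open>The twist and its failure to be multiplicative\<close>

locale wreath_pair = wreath H G + i: group_hom H L i + j: group_hom H L j
  for H :: "('h, 'm) monoid_scheme" and G :: "('g, 'n) monoid_scheme"
    and L :: "('l, 'k) monoid_scheme" and i j
begin

sublocale LG: wreath L G ..

abbreviation \<Theta> where "\<Theta> \<equiv> wreath_twist L G i j"

lemma twist_closed:
  assumes t: "t \<in> carrier G"
  shows "\<Theta> t \<in> carrier W \<rightarrow> carrier LG.W"
proof
  fix x assume "x \<in> carrier W"
  then obtain f g where x: "x = (f, g)" "f \<in> finsupp" "g \<in> carrier G"
    by (auto simp: carrier_W)
  have "(\<lambda>x\<in>carrier G. i (f x) \<otimes>\<^bsub>L\<^esub> j (f (x \<otimes>\<^bsub>G\<^esub> inv\<^bsub>G\<^esub> t))) \<in> LG.finsupp"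
  proof (rule LG.finsupp_restrictI)
    \<comment> \<open>The \<open>i\<close> factor lives on the support of \<open>f\<close>, the
      \<open>j\<close> factor on its right translate by \<open>t\<close>.\<close>
    show "finite (supp f \<union> (\<lambda>y. y \<otimes>\<^bsub>G\<^esub> t) ` supp f)" using x by (simp add: finsuppD)
    fix x assume xc: "x \<in> carrier G" and xn: "x \<notin> supp f \<union> (\<lambda>y. y \<otimes>\<^bsub>G\<^esub> t) ` supp f"
    have "x = x \<otimes>\<^bsub>G\<^esub> inv\<^bsub>G\<^esub> t \<otimes>\<^bsub>G\<^esub> t" using xc t by (simp add: G.m_assoc)
    with xn have "x \<otimes>\<^bsub>G\<^esub> inv\<^bsub>G\<^esub> t \<notin> supp f" by blast
    with xn xc t show "i (f x) \<otimes>\<^bsub>L\<^esub> j (f (x \<otimes>\<^bsub>G\<^esub> inv\<^bsub>G\<^esub> t)) = \<one>\<^bsub>L\<^esub>"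
      by (simp add: supp_def)
  qed (use t x in \<open>simp add: finsuppD\<close>)
  then show "\<Theta> t x \<in> carrier LG.W"
    using x by (simp add: wreath_twist_def LG.carrier_W)
qed

text \<open>The two sides differ at a coordinate only by the order of one value of \<open>j\<close>
  on \<open>f\<close> and one value of \<open>i\<close> on \<open>f'\<close>. Both are nontrivial
  only if \<open>t\<close> is in a finite set determined by the two supports. The filter expresses
  "all but finitely many elements of \<open>G\<close>".\<close>

lemma eventually_twist_mult:
  assumes "x \<in> carrier W" "y \<in> carrier W"
  shows "\<forall>\<^sub>F t in inf cofinite (principal (carrier G)). \<Theta> t (x \<otimes>\<^bsub>W\<^esub> y) = \<Theta> t x \<otimes>\<^bsub>LG.W\<^esub> \<Theta> t y"
proof -
  obtain f g f' g' where xy: "x = (f, g)" "y = (f', g')"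
    and f: "f \<in> finsupp" "f' \<in> finsupp" and g: "g \<in> carrier G" "g' \<in> carrier G"
    using assms by (auto simp: carrier_W)
  let ?D = "(\<lambda>(a, b). inv\<^bsub>G\<^esub> a \<otimes>\<^bsub>G\<^esub> (g \<otimes>\<^bsub>G\<^esub> b)) ` (supp f \<times> supp f')"
  have "\<Theta> t (x \<otimes>\<^bsub>W\<^esub> y) = \<Theta> t x \<otimes>\<^bsub>LG.W\<^esub> \<Theta> t y" if t: "t \<in> carrier G" "t \<notin> ?D" for t
  proof -
    have "i (f z \<otimes>\<^bsub>H\<^esub> f' (inv\<^bsub>G\<^esub> g \<otimes>\<^bsub>G\<^esub> z)) \<otimes>\<^bsub>L\<^esub>
          j (f (z \<otimes>\<^bsub>G\<^esub> inv\<^bsub>G\<^esub> t) \<otimes>\<^bsub>H\<^esub> f' (inv\<^bsub>G\<^esub> g \<otimes>\<^bsub>G\<^esub> (z \<otimes>\<^bsub>G\<^esub> inv\<^bsub>G\<^esub> t))) =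
        i (f z) \<otimes>\<^bsub>L\<^esub> j (f (z \<otimes>\<^bsub>G\<^esub> inv\<^bsub>G\<^esub> t)) \<otimes>\<^bsub>L\<^esub>
          (i (f' (inv\<^bsub>G\<^esub> g \<otimes>\<^bsub>G\<^esub> z)) \<otimes>\<^bsub>L\<^esub> j (f' (inv\<^bsub>G\<^esub> g \<otimes>\<^bsub>G\<^esub> z \<otimes>\<^bsub>G\<^esub> inv\<^bsub>G\<^esub> t)))"
      if z: "z \<in> carrier G" for z
    proof -
      define a where "a = z \<otimes>\<^bsub>G\<^esub> inv\<^bsub>G\<^esub> t"
      define b where "b = inv\<^bsub>G\<^esub> g \<otimes>\<^bsub>G\<^esub> z"
      have ab: "a \<in> carrier G" "b \<in> carrier G" using z t g by (simp_all add: a_def b_def)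
      \<comment> \<open>Eliminate \<open>z\<close> from the definitions: it equals both
        \<open>a\<close> times \<open>t\<close> and \<open>g\<close> times \<open>b\<close>.\<close>
      have "t = inv\<^bsub>G\<^esub> a \<otimes>\<^bsub>G\<^esub> (g \<otimes>\<^bsub>G\<^esub> b)"
        using z t g by (simp add: a_def b_def G.inv_mult_group G.m_assoc G.inv_solve_left)
          (simp add: G.m_assoc [symmetric])
      then have "a \<notin> supp f \<or> b \<notin> supp f'" using t(2) by auto
      then have "f a = \<one>\<^bsub>H\<^esub> \<or> f' b = \<one>\<^bsub>H\<^esub>" using ab by (auto simp: supp_def)
      then have comm: "i (f' b) \<otimes>\<^bsub>L\<^esub> j (f a) = j (f a) \<otimes>\<^bsub>L\<^esub> i (f' b)"
        using ab f by (auto simp: finsuppD)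
      have cl: "f z \<in> carrier H" "f a \<in> carrier H" "f' b \<in> carrier H"
        "f' (b \<otimes>\<^bsub>G\<^esub> inv\<^bsub>G\<^esub> t) \<in> carrier H"
        using z ab f t by (simp_all add: finsuppD)
      have "inv\<^bsub>G\<^esub> g \<otimes>\<^bsub>G\<^esub> (z \<otimes>\<^bsub>G\<^esub> inv\<^bsub>G\<^esub> t) = b \<otimes>\<^bsub>G\<^esub> inv\<^bsub>G\<^esub> t"
        using z t g by (simp add: b_def G.m_assoc)
      with cl show ?thesis
        by (simp add: a_def [symmetric] b_def [symmetric] i.H.m_assoc)
          (simp add: i.H.m_assoc [symmetric] comm)
    qed
    then show ?thesis
      using t g by (auto simp: xy mult_W LG.mult_W wreath_twist_def G.m_assoc)
  qed
  moreover have "finite ?D" using f by (simp add: finsuppD)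
  ultimately show ?thesis
    unfolding eventually_inf_principal eventually_cofinite
    by (rule_tac finite_subset [of _ ?D]) auto
qed

lemma twist_top_elem:
  assumes "g \<in> carrier G" "t \<in> carrier G"
  shows "\<Theta> t (top_elem g) = LG.top_elem g"
  using assms by (auto simp: wreath_twist_def top_elem_def LG.top_elem_def)

section \<open>The commutator that detects the parameter of the twist\<close>

definition twisted :: "'g \<Rightarrow> 'h \<Rightarrow> 'g \<Rightarrow> 'l" where
  "twisted t h = (\<lambda>x\<in>carrier G. if x = \<one>\<^bsub>G\<^esub> then i h else if x = t then j h else \<one>\<^bsub>L\<^esub>)"

lemma twisted_finsupp: "h \<in> carrier H \<Longrightarrow> twisted t h \<in> LG.finsupp"
  unfolding twisted_def by (rule LG.finsupp_restrictI [of _ "{\<one>\<^bsub>G\<^esub>, t}"]) auto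

lemma twist_at_one:
  assumes "h \<in> carrier H" "t \<in> carrier G" "t \<noteq> \<one>\<^bsub>G\<^esub>"
  shows "\<Theta> t (at_one h) = (twisted t h, \<one>\<^bsub>G\<^esub>)"
proof -
  have "x \<otimes>\<^bsub>G\<^esub> inv\<^bsub>G\<^esub> t = \<one>\<^bsub>G\<^esub> \<longleftrightarrow> x = t" if "x \<in> carrier G" for x
    using that assms by (metis G.inv_closed G.inv_equality G.inv_inv G.r_inv)
  with assms show ?thesis
    by (auto simp: wreath_twist_def at_one_def twisted_def intro!: restrict_ext)
qed

text \<open>The two base elements are supported at the distinct points one and
  \<open>s\<close>.\<close>

lemma at_one_commute_conj:
  assumes "h \<in> carrier H" "s \<in> carrier G" "s \<noteq> \<one>\<^bsub>G\<^esub>"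
  shows "at_one h \<otimes>\<^bsub>W\<^esub> (top_elem s \<otimes>\<^bsub>W\<^esub> at_one h \<otimes>\<^bsub>W\<^esub> inv\<^bsub>W\<^esub> top_elem s) =
    top_elem s \<otimes>\<^bsub>W\<^esub> at_one h \<otimes>\<^bsub>W\<^esub> inv\<^bsub>W\<^esub> top_elem s \<otimes>\<^bsub>W\<^esub> at_one h"
  unfolding at_one_def
  by (subst commute_conj_iff) (use assms in \<open>auto simp: single_finsupp\<close>)

text \<open>The supports lie in the set of one and \<open>t\<close> and in its left translate by
  \<open>s\<close>. For \<open>s\<close> different from one they can meet only at \<open>t\<close>,
  when \<open>s = t\<close>, or at one, when \<open>s\<close> is the inverse of \<open>t\<close>;
  there \<open>i h\<close> faces \<open>j h\<close>.\<close>

lemma twisted_commute_conj_iff: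
  assumes h: "h \<in> carrier H" and nc: "i h \<otimes>\<^bsub>L\<^esub> j h \<noteq> j h \<otimes>\<^bsub>L\<^esub> i h"
    and t: "t \<in> carrier G" "t \<noteq> \<one>\<^bsub>G\<^esub>" and s: "s \<in> carrier G" "s \<noteq> \<one>\<^bsub>G\<^esub>"
  defines "X \<equiv> (twisted t h, \<one>\<^bsub>G\<^esub>)"
  defines "Y \<equiv> LG.top_elem s \<otimes>\<^bsub>LG.W\<^esub> X \<otimes>\<^bsub>LG.W\<^esub> inv\<^bsub>LG.W\<^esub> LG.top_elem s"
  shows "X \<otimes>\<^bsub>LG.W\<^esub> Y = Y \<otimes>\<^bsub>LG.W\<^esub> X \<longleftrightarrow> s \<noteq> t \<and> s \<noteq> inv\<^bsub>G\<^esub> t"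
proof -
  let ?u = "twisted t h"
  have "(\<forall>x\<in>carrier G. ?u x \<otimes>\<^bsub>L\<^esub> ?u (inv\<^bsub>G\<^esub> s \<otimes>\<^bsub>G\<^esub> x) = ?u (inv\<^bsub>G\<^esub> s \<otimes>\<^bsub>G\<^esub> x) \<otimes>\<^bsub>L\<^esub> ?u x)
      \<longleftrightarrow> s \<noteq> t \<and> s \<noteq> inv\<^bsub>G\<^esub> t" (is "?L \<longleftrightarrow> ?R")
  proof
    assume L: ?L
    have "s \<noteq> t"
      using bspec [OF L t(1)] nc t s by (auto simp: twisted_def)
    moreover have "s \<noteq> inv\<^bsub>G\<^esub> t"
      using bspec [OF L G.one_closed] nc t s by (auto simp: twisted_def)
    ultimately show ?R ..
  next
    assume R: ?R
    show ?L
    proof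
      fix x assume x: "x \<in> carrier G"
      have "?u x = \<one>\<^bsub>L\<^esub> \<or> ?u (inv\<^bsub>G\<^esub> s \<otimes>\<^bsub>G\<^esub> x) = \<one>\<^bsub>L\<^esub>"
      proof (rule ccontr)
        assume "\<not> ?thesis"
        then have "x \<in> {\<one>\<^bsub>G\<^esub>, t}" "inv\<^bsub>G\<^esub> s \<otimes>\<^bsub>G\<^esub> x \<in> {\<one>\<^bsub>G\<^esub>, t}"
          using x s by (auto simp: twisted_def split: if_splits)
        then show False
          using R s t by (auto simp: G.inv_solve_left' G.inv_eq_1_iff)
      qed
      then show "?u x \<otimes>\<^bsub>L\<^esub> ?u (inv\<^bsub>G\<^esub> s \<otimes>\<^bsub>G\<^esub> x) = ?u (inv\<^bsub>G\<^esub> s \<otimes>\<^bsub>G\<^esub> x) \<otimes>\<^bsub>L\<^esub> ?u x"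
        using x s LG.finsuppD(1) [OF twisted_finsupp [OF h, of t]] by fastforce
    qed
  qed
  then show ?thesis
    unfolding X_def Y_def LG.commute_conj_iff [OF s(1) twisted_finsupp [OF h]] .
qed

text \<open>The criterion for \<open>Frak_C\<close> is applied to the kernels of the homomorphisms
  \<open>\<theta> t\<close>. Eventual agreement with \<open>\<Theta> t\<close> gives membership of
  the words of the kernel of \<open>\<phi>\<close>; a commutator word separates the kernels.\<close>

lemma cb_rank_kernel:
  assumes \<phi>: "\<phi> \<in> epi (free_group d) W"
    and B: "finite B" "B \<subseteq> carrier G" "generate G B = carrier G" and inf: "infinite (carrier G)"
    and h: "h \<in> carrier H" and nc: "i h \<otimes>\<^bsub>L\<^esub> j h \<noteq> j h \<otimes>\<^bsub>L\<^esub> i h"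
  shows "cb_rank (marked_groups d) (kernel (free_group d) W \<phi>) = (Frak_C :: 'o::{wellorder,no_top} cb_value)"
proof -
  let ?F = "free_group d"
  define \<F> where "\<F> = inf cofinite (principal (carrier G))"
  define \<theta> where "\<theta> t = word_eval LG.W (\<lambda>k. \<Theta> t (\<phi> [(k, True)]))" for t
  interpret F: group ?F by (rule group_free_group)
  interpret \<phi>: group_hom ?F W \<phi>
    using \<phi> by unfold_locales (simp add: epi_def)
  interpret top: group_hom G W top_elem
    by unfold_locales (rule top_elem_hom)
  interpret LG_top: group_hom G LG.W LG.top_elem
    by unfold_locales (rule LG.top_elem_hom)
  have letter: "[(k, True)] \<in> carrier ?F" if "k < d" for k
    using that by (simp add: carrier_free_group_iff reduced_def)
  have \<theta>: "group_hom ?F LG.W (\<theta> t)" if "t \<in> carrier G" for t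
    unfolding group_hom_def group_hom_axioms_def \<theta>_def
    using twist_closed [OF that] letter \<phi>.hom_closed
    by (intro conjI F.is_group LG.group_W LG.W.word_eval_hom) blast
  have in_G: "\<forall>\<^sub>F t in \<F>. t \<in> carrier G"
    by (simp add: \<F>_def eventually_inf_principal)
  have "\<forall>\<^sub>F t in \<F>. \<Theta> t \<in> carrier W \<rightarrow> carrier LG.W"
    using in_G by eventually_elim (rule twist_closed)
  then have agree: "\<forall>\<^sub>F t in \<F>. \<theta> t w = \<Theta> t (\<phi> w)" if "w \<in> carrier ?F" for w
    unfolding \<theta>_def using that eventually_twist_mult
    by (intro eventually_word_eval_eq [OF group_W LG.group_W \<phi>.homh]) (simp_all add: \<F>_def)
  have surj: "\<exists>w\<in>carrier ?F. \<phi> w = x" if "x \<in> carrier W" for x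
  proof -
    have "\<phi> ` carrier ?F = carrier W" using \<phi> by (simp add: epi_def)
    with that show ?thesis by (metis imageE)
  qed
  obtain u where u: "u \<in> carrier ?F" "\<phi> u = at_one h"
    using surj at_one_hom h by (meson hom_in_carrier)
  have "\<exists>w. w \<in> carrier ?F \<and> \<phi> w = top_elem b" if "b \<in> B" for b
    using surj [OF top_elem_closed] that B(2) by blast
  then obtain v where v: "\<And>b. b \<in> B \<Longrightarrow> v b \<in> carrier ?F \<and> \<phi> (v b) = top_elem b"
    by metis
  \<comment> \<open>Agreement is required on finitely many words only, one for
    \<open>at_one h\<close> and one for each generator of \<open>G\<close>, so almost all
    \<open>t\<close> belong to \<open>J\<close>.\<close>
  define J where "J = {t \<in> carrier G. t \<noteq> \<one>\<^bsub>G\<^esub> \<and> \<theta> t u = (twisted t h, \<one>\<^bsub>G\<^esub>)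
    \<and> (\<forall>b\<in>B. \<theta> t (v b) = LG.top_elem b)}"
  have in_J: "\<forall>\<^sub>F t in \<F>. t \<in> J"
  proof -
    have "\<forall>\<^sub>F t in \<F>. \<forall>b\<in>B. \<theta> t (v b) = \<Theta> t (\<phi> (v b))"
      using B(1) v agree by (intro eventually_ball_finite) blast+
    moreover have "\<forall>\<^sub>F t in \<F>. t \<noteq> \<one>\<^bsub>G\<^esub>"
      by (simp add: \<F>_def eventually_inf_principal eventually_cofinite)
    ultimately show ?thesis
      using in_G agree [OF u(1)]
    proof eventually_elim
      case (elim t)
      with u v h B(2) show ?case
        unfolding J_def by (auto simp: twist_at_one twist_top_elem subset_iff)
    qed
  qed
  \<comment> \<open>The separating word for \<open>s\<close> must have known values under all
    \<open>\<theta> t\<close> with \<open>t\<close> in \<open>J\<close> at once, whereas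
    \<open>agree\<close> has exceptions depending on the word. Words built from the
    \<open>v b\<close> avoid this, since each \<open>\<theta> t\<close> is a homomorphism.\<close>
  have lift: "\<exists>w\<in>carrier ?F. \<phi> w = top_elem g \<and> (\<forall>t\<in>J. \<theta> t w = LG.top_elem g)"
    if "g \<in> carrier G" for g
  proof -
    have \<theta>_J: "group_hom ?F LG.W (\<theta> t)" if "t \<in> J" for t
      using that \<theta> by (simp add: J_def)
    note gen = G.generate_in_carrier [OF B(2)]
    have "g \<in> generate G B" using that B(3) by simp
    then show ?thesis
    proof (induction g rule: generate.induct)
      case one
      show ?case
        by (rule bexI [of _ "\<one>\<^bsub>?F\<^esub>"])
          (use group_hom.hom_one [OF \<theta>_J] \<phi>.hom_one in \<open>simp_all del: one_free_group\<close>)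
    next
      case (incl b)
      with v show ?case by (auto simp: J_def)
    next
      case (inv b)
      then have b: "b \<in> carrier G" using B(2) by blast
      show ?case
      proof (rule bexI [of _ "inv\<^bsub>?F\<^esub> v b"], intro conjI ballI)
        show "\<phi> (inv\<^bsub>?F\<^esub> v b) = top_elem (inv\<^bsub>G\<^esub> b)"
          using v [OF inv] b by simp
        show "\<theta> t (inv\<^bsub>?F\<^esub> v b) = LG.top_elem (inv\<^bsub>G\<^esub> b)" if "t \<in> J" for t
          using v [OF inv] b group_hom.hom_inv [OF \<theta>_J [OF that]] that inv by (simp add: J_def)
        show "inv\<^bsub>?F\<^esub> v b \<in> carrier ?F" using v [OF inv] by simp
      qed
    next
      case (eng a b)
      then obtain wa wb where wa: "wa \<in> carrier ?F" "\<phi> wa = top_elem a" "\<forall>t\<in>J. \<theta> t wa = LG.top_elem a"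
        and wb: "wb \<in> carrier ?F" "\<phi> wb = top_elem b" "\<forall>t\<in>J. \<theta> t wb = LG.top_elem b"
        by blast
      have ab: "a \<in> carrier G" "b \<in> carrier G" using eng gen by auto
      show ?case
      proof (rule bexI [of _ "wa \<otimes>\<^bsub>?F\<^esub> wb"], intro conjI ballI)
        show "\<phi> (wa \<otimes>\<^bsub>?F\<^esub> wb) = top_elem (a \<otimes>\<^bsub>G\<^esub> b)"
          using \<phi>.hom_mult [OF wa(1) wb(1)] wa wb ab by (simp del: mult_free_group)
        show "\<theta> t (wa \<otimes>\<^bsub>?F\<^esub> wb) = LG.top_elem (a \<otimes>\<^bsub>G\<^esub> b)" if "t \<in> J" for t
          using group_hom.hom_mult [OF \<theta>_J [OF that] wa(1) wb(1)] wa wb ab that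
          by (simp del: mult_free_group)
        show "wa \<otimes>\<^bsub>?F\<^esub> wb \<in> carrier ?F" using wa wb F.m_closed by blast
      qed
    qed
  qed
  show ?thesis
  proof (rule cb_rank_eq_Frak_C_if_eventually_mem [where \<F> = \<F> and J = J
        and K = "\<lambda>t. kernel ?F LG.W (\<theta> t)"])
    show "kernel ?F W \<phi> \<lhd> ?F" by (rule \<phi>.normal_kernel)
    show "kernel ?F LG.W (\<theta> t) \<lhd> ?F" if "t \<in> J" for t
      using that by (intro group_hom.normal_kernel \<theta>) (simp add: J_def)
    \<comment> \<open>Here the infinitude of \<open>G\<close> enters.\<close>
    show "\<F> \<noteq> bot"
      using inf unfolding \<F>_def trivial_limit_def
      by (simp add: eventually_inf_principal eventually_cofinite)
    show "\<forall>\<^sub>F t in \<F>. w \<in> kernel ?F LG.W (\<theta> t)" if "w \<in> kernel ?F W \<phi>" for w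
    proof -
      have w: "w \<in> carrier ?F" "\<phi> w = \<one>\<^bsub>W\<^esub>"
        using that by (auto simp: kernel_def)
      have one: "\<Theta> t \<one>\<^bsub>W\<^esub> = \<one>\<^bsub>LG.W\<^esub>" if "t \<in> carrier G" for t
        using twist_top_elem [OF G.one_closed that] by simp
      from agree [OF w(1)] in_G show ?thesis
        by eventually_elim (simp add: kernel_def w one)
    qed
    show "\<forall>\<^sub>F s in \<F>. s \<in> J \<and> \<not> kernel ?F W \<phi> \<inter> (\<Inter>t\<in>T. kernel ?F LG.W (\<theta> t)) \<subseteq> kernel ?F LG.W (\<theta> s)"
      if T: "finite T" "T \<subseteq> J" for T
    proof -
      \<comment> \<open>By \<open>z_iff\<close> below, these are the \<open>s\<close> whose
        commutator word is killed by every \<open>\<theta> t\<close> with \<open>t\<close> in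
        \<open>T\<close>; taking \<open>t = s\<close> shows that \<open>\<theta> s\<close> does not
        kill it.\<close>
      have "\<forall>\<^sub>F s in \<F>. s \<notin> T \<union> m_inv G ` T"
        unfolding \<F>_def eventually_inf_principal eventually_cofinite
        by (rule finite_subset [of _ "T \<union> m_inv G ` T"]) (use T(1) in auto)
      with in_J show ?thesis
      proof eventually_elim
        case (elim s)
        then have s: "s \<in> carrier G" "s \<noteq> \<one>\<^bsub>G\<^esub>" by (auto simp: J_def)
        obtain w where w: "w \<in> carrier ?F" "\<phi> w = top_elem s" "\<And>t. t \<in> J \<Longrightarrow> \<theta> t w = LG.top_elem s"
          using lift [OF s(1)] by blast
        define c where "c = w \<otimes>\<^bsub>?F\<^esub> u \<otimes>\<^bsub>?F\<^esub> inv\<^bsub>?F\<^esub> w"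
        define z where "z = (u \<otimes>\<^bsub>?F\<^esub> c) \<otimes>\<^bsub>?F\<^esub> inv\<^bsub>?F\<^esub> (c \<otimes>\<^bsub>?F\<^esub> u)"
        have "z \<in> kernel ?F W \<phi>"
          unfolding z_def c_def \<phi>.commutator_conj_in_kernel_iff [OF u(1) w(1)] u(2) w(2)
          by (rule at_one_commute_conj [OF h s])
        moreover have z_iff: "z \<in> kernel ?F LG.W (\<theta> t) \<longleftrightarrow> s \<noteq> t \<and> s \<noteq> inv\<^bsub>G\<^esub> t" if t: "t \<in> J" for t
        proof -
          have tG: "t \<in> carrier G" "t \<noteq> \<one>\<^bsub>G\<^esub>" "\<theta> t u = (twisted t h, \<one>\<^bsub>G\<^esub>)"
            using t by (auto simp: J_def)
          show ?thesis
            unfolding z_def c_def group_hom.commutator_conj_in_kernel_iff [OF \<theta> [OF tG(1)] u(1) w(1)]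
              tG(3) w(3) [OF t]
            by (rule twisted_commute_conj_iff [OF h nc tG(1,2) s])
        qed
        then have "z \<in> kernel ?F LG.W (\<theta> t)" if "t \<in> T" for t
          using that T(2) elim(2) by blast
        moreover have "z \<notin> kernel ?F LG.W (\<theta> s)"
          using z_iff elim(1) by blast
        ultimately show ?case using elim(1) by blast
      qed
    qed
  qed
qed

end

theorem proposition1p6:
  fixes H :: "('h, 'm) monoid_scheme" and G :: "('g, 'n) monoid_scheme"
  assumes "finitely_generated_group H" and "finitely_generated_group G"
    and "carrier H \<noteq> {\<one>\<^bsub>H\<^esub>}" and "infinite (carrier G)"
  shows "cb_e (wreath_product H G) = (Frak_C :: 'o::{wellorder,no_top} cb_value)"
proof -
  interpret H: group H using assms(1) by (simp add: finitely_generated_group_def)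
  obtain B where B: "finite B" "B \<subseteq> carrier G" "generate G B = carrier G" and G: "group G"
    using assms(2) by (auto simp: finitely_generated_group_def)
  obtain h where h: "h \<in> carrier H" "h \<noteq> \<one>\<^bsub>H\<^esub>"
    using assms(3) H.one_closed by blast
  obtain L :: "('h option \<Rightarrow> 'h option) monoid" and i j
    where L: "group L" "i \<in> hom H L" "j \<in> hom H L"
      and nc: "i h \<otimes>\<^bsub>L\<^esub> j h \<noteq> j h \<otimes>\<^bsub>L\<^esub> i h"
    using ex_noncommuting_homs [OF H.group_axioms] h by metis
  interpret wreath_pair H G L i j
    using L G H.group_axioms
    by (simp add: wreath_pair_def wreath_def group_hom_def group_hom_axioms_def)
  have rank: "cb_rank (marked_groups d) (kernel (free_group d) (wreath_product H G) \<phi>) = (Frak_C :: 'o cb_value)"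
    if "\<phi> \<in> epi (free_group d) (wreath_product H G)" for d \<phi>
    by (rule cb_rank_kernel [OF that B assms(4) h(1) nc])
  \<comment> \<open>The description in \<open>cb_e\<close> needs one marking for existence;
    uniqueness holds because \<open>rank\<close> covers all markings.\<close>
  obtain d \<phi> where "\<phi> \<in> epi (free_group d) (wreath_product H G)"
    using W.finitely_generated_imp_epi finitely_generated_wreath_product [OF assms(1,2)] by blast
  then show ?thesis
    unfolding cb_e_def by (intro the_equality) (use rank in auto)
qed

end
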